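(* Let $n\ge1$ and suppose that $\hat f:\hat{\mathbb Q}\to\hat{\mathbb R}$ and $\hat g:\hat{\mathbb Q}^n\to\hat{\mathbb R}$ are two standard dual quaternion functions. Then their composite function $\hat h=\hat f\circ\hat g:\hat{\mathbb Q}^n\to\hat{\mathbb R}$, $\hat h(\hat{\mathbf x})=\hat f(\hat g(\hat{\mathbf x}))$, is also a standard dual quaternion function.
   Context: Dual numbers: $\hat{\mathbb R}$ is the set of $\hat q=q+q_d\epsilon$ with $q,q_d\in\mathbb R$, where $\epsilon^2=0$; $q$ is the standard part and $q_d$ the dual part. Dual quaternions: $\hat{\mathbb Q}$ is the set of $\hat q=q+q_d\epsilon$ with $q,q_d\in\mathbb Q$, the real quaternions (note: $\mathbb Q$ denotes quaternions here), where $\epsilon^2=0$ and $\epsilon$ commutes with quaternions. $\hat{\mathbb R}\subset\hat{\mathbb Q}$ via $\mathbb R\subset\mathbb Q$. $\hat{\mathbb Q}^n$ is the set of $n$-dimensional vectors of dual quaternions; write $\hat{\mathbf x}=\mathbf x+\epsilon\mathbf x_d$ with $\mathbf x,\mathbf x_d\in\mathbb Q^n$. An element $\mathbf x\in\mathbb Q^n$ is identified with $\mathbf x+\epsilon\mathbf 0\in\hat{\mathbb Q}^n$. A dual quaternion function is a function $\hat f:\hat{\mathbb Q}^n\to\hat{\mathbb R}$; write $\hat f(\hat{\mathbf x})=f(\hat{\mathbf x})+\epsilon f_d(\hat{\mathbf x})$ with $f(\hat{\mathbf x}),f_d(\hat{\mathbf x})\in\mathbb R$ the standard and dual parts. It is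 a standard dual quaternion function if $f(\hat{\mathbf x})=f(\mathbf x)$ for all $\hat{\mathbf x}=\mathbf x+\epsilon\mathbf x_d\in\hat{\mathbb Q}^n$. *)

theory Defs
  imports "HOL-Analysis.Finite_Cartesian_Product"
begin

section \<open>Real quaternions\<close>

text \<open>\<open>Quat a b c d\<close> is \<open>a + b i + c j + d k\<close>.\<close>

datatype quat = Quat (q_re: real) (q_i: real) (q_j: real) (q_k: real)

lemma quat_eq_iff:
  "p = q \<longleftrightarrow> q_re p = q_re q \<and> q_i p = q_i q \<and> q_j p = q_j q \<and> q_k p = q_k q"
  by (cases p; cases q) simp

instantiation quat :: real_algebra_1
begin

definition "0 = Quat 0 0 0 0"
definition "1 = Quat 1 0 0 0"
definition "p + q = Quat (q_re p + q_re q) (q_i p + q_i q) (q_j p + q_j q) (q_k p + q_k q)"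
definition "p - q = Quat (q_re p - q_re q) (q_i p - q_i q) (q_j p - q_j q) (q_k p - q_k q)"
definition "- q = Quat (- q_re q) (- q_i q) (- q_j q) (- q_k q)"
definition "scaleR r q = Quat (r * q_re q) (r * q_i q) (r * q_j q) (r * q_k q)"
definition "p * q = Quat
  (q_re p * q_re q - q_i p * q_i q - q_j p * q_j q - q_k p * q_k q)
  (q_re p * q_i q + q_i p * q_re q + q_j p * q_k q - q_k p * q_j q)
  (q_re p * q_j q - q_i p * q_k q + q_j p * q_re q + q_k p * q_i q)
  (q_re p * q_k q + q_i p * q_j q - q_j p * q_i q + q_k p * q_re q)"

instance
  by standard
    (simp_all add: quat_eq_iff zero_quat_def one_quat_def plus_quat_def minus_quat_def
      uminus_quat_def scaleR_quat_def times_quat_def algebra_simps)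

end

section \<open>Dual numbers and dual quaternions\<close>

text \<open>\<open>Dual q p\<close> is \<open>q + p \<epsilon>\<close>, with standard part \<open>q\<close> and dual part \<open>p\<close>, over an arbitrary
  coefficient ring; the multiplication makes \<open>\<epsilon>\<close> central with \<open>\<epsilon>\<^sup>2 = 0\<close>.\<close>

datatype 'a dual = Dual (std: 'a) (dpart: 'a)

lemma dual_eq_iff: "x = y \<longleftrightarrow> std x = std y \<and> dpart x = dpart y"
  by (cases x; cases y) simp

instantiation dual :: (ring_1) ring_1
begin

definition "0 = Dual 0 0"
definition "1 = Dual 1 0"
definition "x + y = Dual (std x + std y) (dpart x + dpart y)"
definition "x - y = Dual (std x - std y) (dpart x - dpart y)"
definition "- x = Dual (- std x) (- dpart x)"
definition "x * y = Dual (std x * std y) (std x * dpart y + dpart x * std y)"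

instance
  by standard
    (simp_all add: dual_eq_iff zero_dual_def one_dual_def plus_dual_def minus_dual_def
      uminus_dual_def times_dual_def algebra_simps)

end

type_synonym dual_real = "real dual"
type_synonym dual_quat = "quat dual"

definition eps :: "'a::ring_1 dual" where
  "eps = Dual 0 1"

text \<open>The identification of \<open>q\<close> with \<open>q + 0 \<epsilon>\<close>.\<close>

definition of_std :: "'a::ring_1 \<Rightarrow> 'a dual" where
  "of_std q = Dual q 0"

lemma eps_square: "eps * eps = 0"
  by (simp add: eps_def times_dual_def zero_dual_def)

lemma eps_commute: "eps * x = x * eps"
  by (simp add: eps_def times_dual_def)

lemma dual_decomp: "x = of_std (std x) + of_std (dpart x) * eps"
  by (simp add: dual_eq_iff of_std_def eps_def times_dual_def plus_dual_def)

text \<open>The inclusion of the dual numbers in the dual quaternions induced by that of the reals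
  in the quaternions.\<close>

definition dual_quat_of_dual :: "dual_real \<Rightarrow> dual_quat" where
  "dual_quat_of_dual a = Dual (of_real (std a)) (of_real (dpart a))"

section \<open>Standard dual quaternion functions\<close>

definition vstd :: "dual_quat ^ 'n \<Rightarrow> quat ^ 'n" where
  "vstd x = (\<chi> i. std (x $ i))"

definition vec_of_std :: "quat ^ 'n \<Rightarrow> dual_quat ^ 'n" where
  "vec_of_std x = (\<chi> i. of_std (x $ i))"

definition standard_dqf :: "(dual_quat ^ 'n \<Rightarrow> dual_real) \<Rightarrow> bool" where
  "standard_dqf f \<longleftrightarrow> (\<forall>x. std (f x) = std (f (vec_of_std (vstd x))))"

text \<open>A function of one dual quaternion, regarded as a function of one-dimensional vectors.\<close>

definition on_vec1 :: "(dual_quat \<Rightarrow> dual_real) \<Rightarrow> dual_quat ^ 1 \<Rightarrow> dual_real" where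
  "on_vec1 f x = f (x $ 1)"

end

theory Submission
  imports Defs
begin

text \<open>Being standard means that the standard part of the value depends only on the standard
  part of the argument. The inclusion \<open>dual_quat_of_dual\<close> acts on standard parts
  separately, so this dependence passes through the composite.\<close>

lemma standard_dqf_on_vec1D:
  assumes "standard_dqf (on_vec1 f)"
  shows "std (f a) = std (f (of_std (std a)))"
  using assms[unfolded standard_dqf_def, rule_format, of "\<chi> i. a"]
  by (simp add: on_vec1_def vec_of_std_def vstd_def)

theorem theorem3p5:
  fixes f :: "dual_quat \<Rightarrow> dual_real"
    and g :: "dual_quat ^ 'n \<Rightarrow> dual_real"
  assumes "standard_dqf (on_vec1 f)"
    and "standard_dqf g"
  shows "standard_dqf (\<lambda>x. f (dual_quat_of_dual (g x)))"
  unfolding standard_dqf_def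
proof
  fix x :: "dual_quat ^ 'n"
  let ?y = "vec_of_std (vstd x)"
  have "std (dual_quat_of_dual (g x)) = std (dual_quat_of_dual (g ?y))"
    using assms(2) by (simp add: standard_dqf_def dual_quat_of_dual_def)
  \<comment> \<open>The dual parts of \<open>g x\<close> and \<open>g ?y\<close> may differ, but
    truncating both arguments of \<open>f\<close> by \<open>of_std\<close> gives the same
    point.\<close>
  then show "std (f (dual_quat_of_dual (g x))) = std (f (dual_quat_of_dual (g ?y)))"
    using standard_dqf_on_vec1D[OF assms(1)] by metis
qed

end
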